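(* Let $g^{ij}(\mathbf u)$ and $\tilde g^{ij}(\mathbf u)$ be non-degenerate symmetric contravariant metrics (symmetric bivectors) on a domain in $\mathbb R^n$ with coordinates $\mathbf u=(u^1,\dots,u^n)$, and assume that $g$ is flat. Then the Mokhov conditions $$T^{ijk}=T^{kji},\qquad T^{ijk}+T^{jki}+T^{kij}=0,\qquad T^{ijs}T^r_{st}=T^{irs}T^j_{st},\qquad \nabla T^{ijk}=0,\qquad \tilde\nabla T^{ijk}=0$$ hold if and only if the following three conditions hold: (1) in flat coordinates of $g$ (coordinates in which the components $g^{ij}$ are constant) the components $\tilde g^{ij}$ are polynomials of degree at most one in the coordinates (equivalently, $\nabla^2\tilde g=0$); (2) the Nijenhuis torsion of the affinor $L^i_j=\tilde g^{il}g_{lj}$ vanishes; (3) $\tilde g$ satisfies the Killing condition $\nabla^i\tilde g^{kj}+\nabla^k\tilde g^{ij}+\nabla^j\tilde g^{ik}=0$. In particular, if $g$ is flat and conditions (1)–(3) hold, then $\tilde g$ is also flat.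
   Context: $g_{ij}$ denotes the inverse of $g^{ij}$. $\Gamma^i_{jk}$ and $\tilde\Gamma^i_{jk}$ are the Christoffel symbols of the Levi-Civita connections $\nabla$, $\tilde\nabla$ of $g$ and $\tilde g$ respectively. The obstruction tensor is $T^i_{jk}=\tilde\Gamma^i_{jk}-\Gamma^i_{jk}$, and $T^{ijk}=g^{ir}\tilde g^{ks}T^j_{rs}$; indices of $T$ are raised with $g$ as needed (e.g. $T^{ijs}T^r_{st}$ uses the mixed tensor $T^r_{st}$). $\nabla^i=g^{is}\nabla_s$. The Nijenhuis torsion of an affinor $L$ is $\mathcal N^k_{ij}=L^s_i\partial_sL^k_j-L^s_j\partial_sL^k_i+L^k_s\partial_jL^s_i-L^k_s\partial_iL^s_j$. (By a theorem of Mokhov, for flat $g,\tilde g$ the Mokhov conditions are equivalent to the operator $P^{ij}=g^{ij}\frac{d}{dx}-g^{is}\Gamma^j_{sk}u^k_x+\tilde g^{ij}\frac{d}{dy}-\tilde g^{is}\tilde\Gamma^j_{sk}u^k_y$ being Hamiltonian.) *)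

theory Defs
  imports "HOL-Analysis.Analysis"
begin

text \<open>Everything is written in a fixed coordinate chart: points are u :: real^'n,
  a contravariant metric is a matrix-valued function g with g^{ij}(u) = g u $ i $ j.\<close>

type_synonym 'n field2 = "real^'n \<Rightarrow> real^'n^'n"

definition pd :: "'n::finite \<Rightarrow> (real^'n \<Rightarrow> real) \<Rightarrow> real^'n \<Rightarrow> real" where
  "pd i f x = deriv (\<lambda>t. f (x + t *\<^sub>R axis i 1)) 0"

primrec iterpd :: "'n::finite list \<Rightarrow> (real^'n \<Rightarrow> real) \<Rightarrow> real^'n \<Rightarrow> real" where
  "iterpd [] f = f"
| "iterpd (i # is) f = pd i (iterpd is f)"

definition smooth_fun_on :: "(real^'n::finite) set \<Rightarrow> (real^'n \<Rightarrow> real) \<Rightarrow> bool" where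
  "smooth_fun_on U f \<longleftrightarrow> (\<forall>is. iterpd is f differentiable_on U)"

definition smooth_metric_on :: "(real^'n::finite) set \<Rightarrow> 'n field2 \<Rightarrow> bool" where
  "smooth_metric_on U g \<longleftrightarrow> (\<forall>i j. smooth_fun_on U (\<lambda>x. g x $ i $ j))"

definition nondeg_sym_on :: "(real^'n::finite) set \<Rightarrow> 'n field2 \<Rightarrow> bool" where
  "nondeg_sym_on U g \<longleftrightarrow> (\<forall>x\<in>U. transpose (g x) = g x \<and> det (g x) \<noteq> 0)"

definition lower :: "'n::finite field2 \<Rightarrow> 'n field2" where
  "lower g x = matrix_inv (g x)"

definition christoffel :: "'n::finite field2 \<Rightarrow> 'n \<Rightarrow> 'n \<Rightarrow> 'n \<Rightarrow> real^'n \<Rightarrow> real" where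
  "christoffel g i j k x = (1/2) * (\<Sum>l\<in>UNIV. g x $ i $ l *
      (pd j (\<lambda>y. lower g y $ l $ k) x + pd k (\<lambda>y. lower g y $ l $ j) x
       - pd l (\<lambda>y. lower g y $ j $ k) x))"

definition riemann :: "'n::finite field2 \<Rightarrow> 'n \<Rightarrow> 'n \<Rightarrow> 'n \<Rightarrow> 'n \<Rightarrow> real^'n \<Rightarrow> real" where
  "riemann g i j k l x =
     pd k (christoffel g i l j) x - pd l (christoffel g i k j) x
     + (\<Sum>s\<in>UNIV. christoffel g i k s x * christoffel g s l j x
                 - christoffel g i l s x * christoffel g s k j x)"

definition flat_on :: "(real^'n::finite) set \<Rightarrow> 'n field2 \<Rightarrow> bool" where
  "flat_on U g \<longleftrightarrow> (\<forall>x\<in>U. \<forall>i j k l. riemann g i j k l x = 0)"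

definition obstr :: "'n::finite field2 \<Rightarrow> 'n field2 \<Rightarrow> 'n \<Rightarrow> 'n \<Rightarrow> 'n \<Rightarrow> real^'n \<Rightarrow> real" where
  "obstr g gt i j k x = christoffel gt i j k x - christoffel g i j k x"

definition obstr_up :: "'n::finite field2 \<Rightarrow> 'n field2 \<Rightarrow> 'n \<Rightarrow> 'n \<Rightarrow> 'n \<Rightarrow> real^'n \<Rightarrow> real" where
  "obstr_up g gt i j k x = (\<Sum>r\<in>UNIV. \<Sum>s\<in>UNIV. g x $ i $ r * gt x $ k $ s * obstr g gt j r s x)"

text \<open>Covariant derivative nabla_l of a (3,0)-tensor w.r.t. connection coefficients C i j k = C^i_{jk}.\<close>
definition covd3 :: "('n::finite \<Rightarrow> 'n \<Rightarrow> 'n \<Rightarrow> real^'n \<Rightarrow> real) \<Rightarrow>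
    ('n \<Rightarrow> 'n \<Rightarrow> 'n \<Rightarrow> real^'n \<Rightarrow> real) \<Rightarrow> 'n \<Rightarrow> 'n \<Rightarrow> 'n \<Rightarrow> 'n \<Rightarrow> real^'n \<Rightarrow> real" where
  "covd3 C T l i j k x = pd l (T i j k) x
     + (\<Sum>s\<in>UNIV. C i l s x * T s j k x + C j l s x * T i s k x + C k l s x * T i j s x)"

definition covd2 :: "('n::finite \<Rightarrow> 'n \<Rightarrow> 'n \<Rightarrow> real^'n \<Rightarrow> real) \<Rightarrow>
    ('n \<Rightarrow> 'n \<Rightarrow> real^'n \<Rightarrow> real) \<Rightarrow> 'n \<Rightarrow> 'n \<Rightarrow> 'n \<Rightarrow> real^'n \<Rightarrow> real" where
  "covd2 C A l i j x = pd l (A i j) x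
     + (\<Sum>s\<in>UNIV. C i l s x * A s j x + C j l s x * A i s x)"

definition covd21 :: "('n::finite \<Rightarrow> 'n \<Rightarrow> 'n \<Rightarrow> real^'n \<Rightarrow> real) \<Rightarrow>
    ('n \<Rightarrow> 'n \<Rightarrow> 'n \<Rightarrow> real^'n \<Rightarrow> real) \<Rightarrow> 'n \<Rightarrow> 'n \<Rightarrow> 'n \<Rightarrow> 'n \<Rightarrow> real^'n \<Rightarrow> real" where
  "covd21 C D m i j l x = pd m (D i j l) x
     + (\<Sum>s\<in>UNIV. C i m s x * D s j l x + C j m s x * D i s l x - C s m l x * D i j s x)"

definition comps :: "'n::finite field2 \<Rightarrow> 'n \<Rightarrow> 'n \<Rightarrow> real^'n \<Rightarrow> real" where
  "comps g i j x = g x $ i $ j"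

definition mokhov_on :: "(real^'n::finite) set \<Rightarrow> 'n field2 \<Rightarrow> 'n field2 \<Rightarrow> bool" where
  "mokhov_on U g gt \<longleftrightarrow> (\<forall>x\<in>U.
     (\<forall>i j k. obstr_up g gt i j k x = obstr_up g gt k j i x)
   \<and> (\<forall>i j k. obstr_up g gt i j k x + obstr_up g gt j k i x + obstr_up g gt k i j x = 0)
   \<and> (\<forall>i j r t. (\<Sum>s\<in>UNIV. obstr_up g gt i j s x * obstr g gt r s t x)
              = (\<Sum>s\<in>UNIV. obstr_up g gt i r s x * obstr g gt j s t x))
   \<and> (\<forall>l i j k. covd3 (christoffel g) (obstr_up g gt) l i j k x = 0)
   \<and> (\<forall>l i j k. covd3 (christoffel gt) (obstr_up g gt) l i j k x = 0))"

text \<open>Condition (1): nabla^2 gt = 0 (gt is linear in flat coordinates of g).\<close>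
definition cond_linear_on :: "(real^'n::finite) set \<Rightarrow> 'n field2 \<Rightarrow> 'n field2 \<Rightarrow> bool" where
  "cond_linear_on U g gt \<longleftrightarrow> (\<forall>x\<in>U. \<forall>m i j l.
     covd21 (christoffel g) (\<lambda>i j l. covd2 (christoffel g) (comps gt) l i j) m i j l x = 0)"

definition affinor :: "'n::finite field2 \<Rightarrow> 'n field2 \<Rightarrow> 'n \<Rightarrow> 'n \<Rightarrow> real^'n \<Rightarrow> real" where
  "affinor g gt i j x = (\<Sum>l\<in>UNIV. gt x $ i $ l * lower g x $ l $ j)"

definition nijenhuis :: "('n::finite \<Rightarrow> 'n \<Rightarrow> real^'n \<Rightarrow> real) \<Rightarrow> 'n \<Rightarrow> 'n \<Rightarrow> 'n \<Rightarrow> real^'n \<Rightarrow> real" where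
  "nijenhuis L k i j x = (\<Sum>s\<in>UNIV.
       L s i x * pd s (L k j) x - L s j x * pd s (L k i) x
     + L k s x * pd j (L s i) x - L k s x * pd i (L s j) x)"

definition cond_nijenhuis_on :: "(real^'n::finite) set \<Rightarrow> 'n field2 \<Rightarrow> 'n field2 \<Rightarrow> bool" where
  "cond_nijenhuis_on U g gt \<longleftrightarrow> (\<forall>x\<in>U. \<forall>k i j. nijenhuis (affinor g gt) k i j x = 0)"

definition nabla_up :: "'n::finite field2 \<Rightarrow> 'n field2 \<Rightarrow> 'n \<Rightarrow> 'n \<Rightarrow> 'n \<Rightarrow> real^'n \<Rightarrow> real" where
  "nabla_up g gt i k j x = (\<Sum>s\<in>UNIV. g x $ i $ s * covd2 (christoffel g) (comps gt) s k j x)"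

definition cond_killing_on :: "(real^'n::finite) set \<Rightarrow> 'n field2 \<Rightarrow> 'n field2 \<Rightarrow> bool" where
  "cond_killing_on U g gt \<longleftrightarrow> (\<forall>x\<in>U. \<forall>i j k.
     nabla_up g gt i k j x + nabla_up g gt k i j x + nabla_up g gt j i k x = 0)"

end

theory Submission
  imports Defs
begin

text \<open>
  Write \<open>D\<^sup>i\<^sup>j\<^sup>k = \<nabla>\<^sup>i gt\<^sup>j\<^sup>k\<close>. Two identities hold for any pair of metrics:
  \<open>D\<^sup>i\<^sup>j\<^sup>k + T\<^sup>i\<^sup>j\<^sup>k + T\<^sup>i\<^sup>k\<^sup>j = 0\<close> (the second connection preserves \<open>gt\<close>) and
  \<open>L\<^sup>a\<^sub>s T\<^sup>s\<^sup>j\<^sup>k\<close> is symmetric in \<open>a\<close> and \<open>k\<close> (both connections are torsion-free). As for the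
  Levi-Civita connection, they determine \<open>T\<close> from \<open>D\<close>.

  The first two Mokhov conditions give \<open>T\<^sup>i\<^sup>j\<^sup>k = D\<^sup>j\<^sup>i\<^sup>k\<close>, after which the cyclic condition is the
  Killing condition, the Nijenhuis torsion vanishes by the symmetry of \<open>L T\<close>, and
  \<open>\<nabla> T = 0\<close> says \<open>\<nabla>\<^sup>2 gt = 0\<close>. Conversely, the Killing condition and the vanishing of the
  torsion are exactly what makes \<open>D\<^sup>j\<^sup>i\<^sup>k\<close> a solution of the two identities, so again
  \<open>T\<^sup>i\<^sup>j\<^sup>k = D\<^sup>j\<^sup>i\<^sup>k\<close>, and \<open>T\<close> is parallel. Differentiating the symmetry of \<open>L T\<close> yields
  the quadratic condition, and the remaining claims, \<open>T\<close> parallel for the second connection and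
  \<open>gt\<close> flat, reduce to it. No flat coordinates are used.
\<close>

section \<open>Partial derivatives\<close>

lemma has_pd:
  fixes f :: "real^'n::finite \<Rightarrow> real"
  assumes "f differentiable (at x)"
  shows "((\<lambda>t. f (x + t *\<^sub>R axis i 1)) has_real_derivative pd i f x) (at 0)"
proof -
  from assms obtain f' where f': "(f has_derivative f') (at x)"
    by (auto simp: differentiable_def)
  have "((\<lambda>t. x + t *\<^sub>R axis i 1) has_derivative (\<lambda>t. t *\<^sub>R axis i 1)) (at (0::real))"
    by (auto intro!: derivative_eq_intros)
  from has_derivative_compose[OF this, of f f'] f'
  have "((\<lambda>t. f (x + t *\<^sub>R axis i 1)) has_derivative (\<lambda>t. f' (t *\<^sub>R axis i 1))) (at 0)"
    by simp
  then have "(\<lambda>t. f (x + t *\<^sub>R axis i 1)) differentiable (at 0)"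
    by (auto simp: differentiable_def)
  then show ?thesis
    unfolding pd_def by (meson DERIV_deriv_iff_real_differentiable)
qed

lemma pd_eqI:
  "((\<lambda>t. f (x + t *\<^sub>R axis i 1)) has_real_derivative D) (at 0) \<Longrightarrow> pd i f x = D"
  unfolding pd_def by (rule DERIV_imp_deriv)

lemma pd_const: "pd i (\<lambda>x. c) x = 0"
  by (rule pd_eqI) simp

context
  fixes f h :: "real^'n::finite \<Rightarrow> real" and x
  assumes f: "f differentiable (at x)" and h: "h differentiable (at x)"
begin

lemma pd_add: "pd i (\<lambda>x. f x + h x) x = pd i f x + pd i h x"
  by (rule pd_eqI) (intro DERIV_add has_pd f h)

lemma pd_mult: "pd i (\<lambda>x. f x * h x) x = pd i f x * h x + f x * pd i h x"
  by (rule pd_eqI) (use DERIV_mult[OF has_pd[OF f] has_pd[OF h], of i i] in \<open>simp add: mult.commute\<close>)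

end

lemma pd_sum:
  fixes f :: "'b \<Rightarrow> real^'n::finite \<Rightarrow> real"
  assumes "\<And>s. s \<in> S \<Longrightarrow> f s differentiable (at x)"
  shows "pd i (\<lambda>x. \<Sum>s\<in>S. f s x) x = (\<Sum>s\<in>S. pd i (f s) x)"
  by (rule pd_eqI) (intro DERIV_sum has_pd assms)

lemma pd_sum_mult:
  fixes f h :: "'b \<Rightarrow> real^'n::finite \<Rightarrow> real"
  assumes "\<And>s. f s differentiable (at x)" "\<And>s. h s differentiable (at x)"
  shows "pd i (\<lambda>x. \<Sum>s\<in>S. f s x * h s x) x
    = (\<Sum>s\<in>S. pd i (f s) x * h s x + f s x * pd i (h s) x)"
  by (subst pd_sum) (simp_all add: pd_mult assms)

text \<open>Identities are available only on \<open>U\<close>; as \<open>U\<close> is open, the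
  coordinate line through \<open>x\<close> stays in it for small \<open>t\<close>, which is all that
  \<open>deriv\<close> sees.\<close>

lemma pd_cong:
  fixes f h :: "real^'n::finite \<Rightarrow> real"
  assumes "open U" "x \<in> U" and eq: "\<And>y. y \<in> U \<Longrightarrow> f y = h y"
  shows "pd i f x = pd i h x"
proof -
  have "((\<lambda>t::real. x + t *\<^sub>R axis i 1) \<longlongrightarrow> x + 0 *\<^sub>R axis i 1) (nhds 0)"
    by (intro tendsto_intros filterlim_ident)
  then have "eventually (\<lambda>t::real. x + t *\<^sub>R axis i 1 \<in> U) (nhds 0)"
    using assms(1,2) by (auto simp: tendsto_def)
  then have "eventually (\<lambda>t::real. f (x + t *\<^sub>R axis i 1) = h (x + t *\<^sub>R axis i 1)) (nhds 0)"
    by eventually_elim (rule eq)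
  then show ?thesis
    unfolding pd_def by (rule deriv_cong_ev) simp
qed

lemma differentiable_cong_open:
  assumes "open U" "x \<in> U" "\<And>y. y \<in> U \<Longrightarrow> f y = h y" "h differentiable (at x)"
  shows "f differentiable (at x)"
  using assms has_derivative_transform_within_open[of h _ x UNIV U f]
  unfolding differentiable_def by metis

lemma differentiable_prod:
  fixes f :: "'i \<Rightarrow> 'a::real_normed_vector \<Rightarrow> 'b::real_normed_field"
  assumes "\<And>i. i \<in> I \<Longrightarrow> f i differentiable (at x)"
  shows "(\<lambda>x. \<Prod>i\<in>I. f i x) differentiable (at x)"
  using assms by (induction I rule: infinite_finite_induct) auto

lemma differentiable_det:
  fixes A :: "'a::real_normed_vector \<Rightarrow> real^'n::finite^'n"
  assumes "\<And>i j. (\<lambda>y. A y $ i $ j) differentiable (at x)"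
  shows "(\<lambda>y. det (A y)) differentiable (at x)"
  unfolding det_def
  by (intro differentiable_sum ballI finite differentiable_mult differentiable_const
      differentiable_prod assms)

section \<open>Contractions with a pair of inverse matrices\<close>

lemma sum_mult_delta [simp]:
  "(\<Sum>s\<in>UNIV. (if i = s then 1 else 0) * f s) = (f (i::'n::finite)::real)"
  "(\<Sum>s\<in>UNIV. (if s = i then 1 else 0) * f s) = (f (i::'n::finite)::real)"
  "(\<Sum>s\<in>UNIV. f s * (if i = s then 1 else 0)) = (f (i::'n::finite)::real)"
  "(\<Sum>s\<in>UNIV. f s * (if s = i then 1 else 0)) = (f (i::'n::finite)::real)"
  by (simp_all add: mult_delta_left mult_delta_right)

lemma sum_contract_assoc:
  fixes A :: "_ \<Rightarrow> real"
  shows "(\<Sum>k\<in>S. A k * (\<Sum>m\<in>R. B k m * f m)) = (\<Sum>m\<in>R. (\<Sum>k\<in>S. A k * B k m) * f m)"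
  unfolding sum_distrib_left sum_distrib_right
  by (subst sum.swap) (simp add: mult.assoc)

text \<open>Stated for index functions, so that a metric and its inverse, in either order, cancel
  inside sums without passing to matrix products.\<close>

definition inverse_pair :: "('n::finite \<Rightarrow> 'n \<Rightarrow> real) \<Rightarrow> ('n \<Rightarrow> 'n \<Rightarrow> real) \<Rightarrow> bool" where
  "inverse_pair A B \<longleftrightarrow> (\<forall>i j. (\<Sum>s\<in>UNIV. A i s * B s j) = (if i = j then 1 else 0))"

lemma inverse_pair_cancel_left:
  assumes "inverse_pair A B"
  shows "(\<Sum>k\<in>UNIV. A b k * (\<Sum>m\<in>UNIV. B k m * f m)) = f b"
  using assms unfolding sum_contract_assoc inverse_pair_def by simp

lemma inverse_pair_cancel_right:
  assumes "inverse_pair A B"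
  shows "(\<Sum>k\<in>UNIV. (\<Sum>m\<in>UNIV. f m * A m k) * B k b) = f b"
  using assms unfolding sum_contract_assoc[symmetric] inverse_pair_def by simp

text \<open>Used below to strip a contracted metric from an identity.\<close>

lemma inverse_pair_injective:
  assumes "inverse_pair A B" and "\<And>k. (\<Sum>m\<in>UNIV. B k m * f m) = (\<Sum>m\<in>UNIV. B k m * h m)"
  shows "f b = h b"
  using inverse_pair_cancel_left[OF assms(1), of b f] inverse_pair_cancel_left[OF assms(1), of b h]
    assms(2) by simp

section \<open>The Levi-Civita connection of a metric\<close>

locale metric_on =
  fixes U :: "(real^'n::finite) set" and g :: "'n field2"
  assumes open_U: "open U"
    and smooth: "smooth_metric_on U g"
    and nondeg_sym: "nondeg_sym_on U g"
begin

lemma metric_differentiable: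
  assumes "x \<in> U"
  shows "(\<lambda>y. g y $ i $ j) differentiable (at x)"
    and "pd l (\<lambda>y. g y $ i $ j) differentiable (at x)"
proof -
  have "iterpd is (\<lambda>y. g y $ i $ j) differentiable (at x)" for "is"
    using smooth open_U assms unfolding smooth_metric_on_def smooth_fun_on_def
    by (metis differentiable_on_eq_differentiable_at)
  from this[of "[]"] this[of "[l]"]
  show "(\<lambda>y. g y $ i $ j) differentiable (at x)" "pd l (\<lambda>y. g y $ i $ j) differentiable (at x)"
    by simp_all
qed

lemma metric_sym: "x \<in> U \<Longrightarrow> g x $ i $ j = g x $ j $ i"
  using nondeg_sym by (auto simp: nondeg_sym_on_def transpose_def vec_eq_iff)

lemma metric_mult_lower:
  assumes "x \<in> U"
  shows "g x ** lower g x = mat 1" "lower g x ** g x = mat 1"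
proof -
  have "invertible (g x)"
    using assms nondeg_sym by (simp add: nondeg_sym_on_def invertible_det_nz)
  then have "g x ** lower g x = mat 1 \<and> lower g x ** g x = mat 1"
    unfolding lower_def matrix_inv_def invertible_def by (rule someI_ex)
  then show "g x ** lower g x = mat 1" "lower g x ** g x = mat 1" by auto
qed

lemma inverse_pairs:
  assumes "x \<in> U"
  shows "inverse_pair (\<lambda>i j. g x $ i $ j) (\<lambda>i j. lower g x $ i $ j)"
    and "inverse_pair (\<lambda>i j. lower g x $ i $ j) (\<lambda>i j. g x $ i $ j)"
  using metric_mult_lower[OF assms]
  by (simp_all add: inverse_pair_def matrix_matrix_mult_def vec_eq_iff mat_def)

lemma lower_sym:
  assumes "x \<in> U"
  shows "lower g x $ i $ j = lower g x $ j $ i"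
proof -
  have t: "transpose (g x) = g x"
    using assms nondeg_sym by (simp add: nondeg_sym_on_def)
  have "transpose (lower g x) = transpose (lower g x) ** (g x ** lower g x)"
    using metric_mult_lower[OF assms] by simp
  also have "\<dots> = transpose (g x ** lower g x) ** lower g x"
    by (simp add: matrix_mul_assoc matrix_transpose_mul t)
  also have "\<dots> = lower g x"
    using metric_mult_lower[OF assms] by simp
  finally show ?thesis by (simp add: transpose_def vec_eq_iff)
qed

lemma lower_differentiable:
  assumes x: "x \<in> U"
  shows "(\<lambda>y. lower g y $ i $ j) differentiable (at x)"
proof (rule differentiable_cong_open[OF open_U x])
  \<comment> \<open>Cramer's rule for the system with right-hand side \<open>axis j 1\<close>:
    \<open>?M y\<close> is \<open>g y\<close> with column \<open>i\<close> replaced by it.\<close>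
  let ?M = "\<lambda>y. (\<chi> a b. if b = i then axis j 1 $ a else g y $ a $ b) :: real^'n^'n"
  show "lower g y $ i $ j = det (?M y) / det (g y)" if y: "y \<in> U" for y
  proof -
    have d: "det (g y) \<noteq> 0" using y nondeg_sym by (simp add: nondeg_sym_on_def)
    have "g y *v (lower g y *v axis j 1) = axis j 1"
      by (simp add: matrix_vector_mul_assoc metric_mult_lower[OF y])
    then have "(lower g y *v axis j 1) $ i = det (?M y) / det (g y)"
      unfolding cramer[OF d] by simp
    then show ?thesis
      by (simp add: matrix_vector_mult_basis column_def)
  qed
  show "(\<lambda>y. det (?M y) / det (g y)) differentiable (at x)"
  proof (intro differentiable_divide differentiable_det)
    show "(\<lambda>y. ?M y $ a $ b) differentiable (at x)" for a b
      by (cases "b = i") (simp_all add: metric_differentiable x)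
    show "(\<lambda>y. g y $ a $ b) differentiable (at x)" for a b
      by (simp add: metric_differentiable x)
    show "det (g x) \<noteq> 0" using x nondeg_sym by (simp add: nondeg_sym_on_def)
  qed
qed

lemma pd_metric_mult_lower:
  assumes x: "x \<in> U"
  shows "(\<Sum>m\<in>UNIV. pd l (\<lambda>y. g y $ a $ m) x * lower g x $ m $ k)
    = - (\<Sum>m\<in>UNIV. g x $ a $ m * pd l (\<lambda>y. lower g y $ m $ k) x)"
proof -
  have "pd l (\<lambda>y. \<Sum>m\<in>UNIV. g y $ a $ m * lower g y $ m $ k) x
      = pd l (\<lambda>y. if a = k then 1 else 0) x"
    using inverse_pairs by (intro pd_cong[OF open_U x]) (simp add: inverse_pair_def)
  then show ?thesis
    by (subst (asm) pd_sum_mult)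
       (simp_all add: metric_differentiable lower_differentiable x pd_const sum.distrib)
qed

text \<open>The formula d(g^-1) = - g^-1 (dg) g^-1, which reduces the differentiability of
  derivatives of \<open>lower g\<close> to that of derivatives of \<open>g\<close>.\<close>

lemma pd_lower:
  assumes x: "x \<in> U"
  shows "pd l (\<lambda>y. lower g y $ m $ k) x
    = - (\<Sum>a\<in>UNIV. lower g x $ m $ a * (\<Sum>b\<in>UNIV. pd l (\<lambda>y. g y $ a $ b) x * lower g x $ b $ k))"
  unfolding pd_metric_mult_lower[OF x]
  by (simp add: sum_negf inverse_pair_cancel_left[OF inverse_pairs(2)[OF x]])

lemma pd_lower_differentiable:
  assumes x: "x \<in> U"
  shows "pd l (\<lambda>y. lower g y $ m $ k) differentiable (at x)"
proof (rule differentiable_cong_open[OF open_U x pd_lower])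
  show "(\<lambda>y. - (\<Sum>a\<in>UNIV. lower g y $ m $ a *
      (\<Sum>b\<in>UNIV. pd l (\<lambda>y. g y $ a $ b) y * lower g y $ b $ k))) differentiable (at x)"
    by (intro differentiable_minus differentiable_sum finite ballI differentiable_mult
        lower_differentiable metric_differentiable x)
qed

lemma christoffel_differentiable:
  assumes x: "x \<in> U"
  shows "christoffel g i j k differentiable (at x)"
  unfolding christoffel_def [abs_def]
  by (intro differentiable_mult differentiable_const differentiable_sum finite ballI
      differentiable_diff differentiable_add pd_lower_differentiable metric_differentiable x)

lemma pd_lower_sym:
  "x \<in> U \<Longrightarrow> pd l (\<lambda>y. lower g y $ i $ j) x = pd l (\<lambda>y. lower g y $ j $ i) x"
  by (rule pd_cong[OF open_U]) (auto intro: lower_sym)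

lemma christoffel_sym: "x \<in> U \<Longrightarrow> christoffel g i j k x = christoffel g i k j x"
  unfolding christoffel_def by (simp add: pd_lower_sym[of x _ j k] add.commute)

text \<open>These are the Christoffel symbols of the first kind; lowering the index cancels the
  leading factor \<open>g x\<close>.\<close>

lemma lower_christoffel:
  assumes x: "x \<in> U"
  shows "(\<Sum>i\<in>UNIV. lower g x $ m $ i * christoffel g i j k x)
    = (pd j (\<lambda>y. lower g y $ m $ k) x + pd k (\<lambda>y. lower g y $ m $ j) x
       - pd m (\<lambda>y. lower g y $ j $ k) x) / 2"
proof -
  have "christoffel g i j k x = (\<Sum>l\<in>UNIV. g x $ i $ l *
      ((pd j (\<lambda>y. lower g y $ l $ k) x + pd k (\<lambda>y. lower g y $ l $ j) x
       - pd l (\<lambda>y. lower g y $ j $ k) x) / 2))" for i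
    unfolding christoffel_def sum_distrib_left by (intro sum.cong) auto
  then show ?thesis
    by (simp only: inverse_pair_cancel_left[OF inverse_pairs(2)[OF x]])
qed

text \<open>Adding two symbols of the first kind cancels all but one derivative: the covariant
  metric is parallel.\<close>

lemma pd_lower_christoffel:
  assumes x: "x \<in> U"
  shows "pd j (\<lambda>y. lower g y $ m $ k) x
    = (\<Sum>i\<in>UNIV. lower g x $ m $ i * christoffel g i j k x)
      + (\<Sum>i\<in>UNIV. lower g x $ k $ i * christoffel g i j m x)"
  unfolding lower_christoffel[OF x]
  by (simp add: pd_lower_sym[OF x, of _ m k] pd_lower_sym[OF x, of _ k j] pd_lower_sym[OF x, of _ m j]
      field_simps)

lemma pd_metric:
  assumes x: "x \<in> U"
  shows "pd l (\<lambda>y. g y $ i $ j) x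
    = - (\<Sum>s\<in>UNIV. christoffel g i l s x * g x $ s $ j + christoffel g j l s x * g x $ i $ s)"
proof -
  let ?P = "\<lambda>k. \<Sum>m\<in>UNIV. g x $ i $ m * pd l (\<lambda>y. lower g y $ m $ k) x"
  have P: "?P k = christoffel g i l k x
      + (\<Sum>q\<in>UNIV. (\<Sum>m\<in>UNIV. g x $ i $ m * christoffel g q l m x) * lower g x $ q $ k)" for k
  proof -
    have swap: "(\<Sum>q\<in>UNIV. lower g x $ k $ q * christoffel g q l m x)
        = (\<Sum>q\<in>UNIV. christoffel g q l m x * lower g x $ q $ k)" for m
      by (intro sum.cong) (simp_all add: lower_sym[OF x, of k])
    have "?P k = (\<Sum>m\<in>UNIV. g x $ i $ m * (\<Sum>q\<in>UNIV. lower g x $ m $ q * christoffel g q l k x))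
      + (\<Sum>m\<in>UNIV. g x $ i $ m * (\<Sum>q\<in>UNIV. christoffel g q l m x * lower g x $ q $ k))"
      unfolding pd_lower_christoffel[OF x] swap distrib_left sum.distrib ..
    then show ?thesis
      unfolding inverse_pair_cancel_left[OF inverse_pairs(1)[OF x]]
      by (subst (asm) sum_contract_assoc)
  qed
  \<comment> \<open>Inserting \<open>lower g x ** g x\<close> trades the derivative of
    \<open>g\<close> for that of \<open>lower g\<close>, whose parallelism is known.\<close>
  have "pd l (\<lambda>y. g y $ i $ j) x
    = (\<Sum>k\<in>UNIV. (\<Sum>m\<in>UNIV. pd l (\<lambda>y. g y $ i $ m) x * lower g x $ m $ k) * g x $ k $ j)"
    by (rule inverse_pair_cancel_right[OF inverse_pairs(2)[OF x], symmetric])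
  also have "\<dots> = - (\<Sum>k\<in>UNIV. ?P k * g x $ k $ j)"
    unfolding pd_metric_mult_lower[OF x] by (simp add: sum_negf)
  also have "(\<Sum>k\<in>UNIV. ?P k * g x $ k $ j) = (\<Sum>k\<in>UNIV. christoffel g i l k x * g x $ k $ j)
      + (\<Sum>m\<in>UNIV. g x $ i $ m * christoffel g j l m x)"
    unfolding P distrib_right sum.distrib
    by (simp only: inverse_pair_cancel_right[OF inverse_pairs(2)[OF x]])
  finally show ?thesis by (simp add: sum.distrib mult.commute)
qed

lemma covd2_metric: "x \<in> U \<Longrightarrow> covd2 (christoffel g) (comps g) l i j x = 0"
  unfolding covd2_def comps_def [abs_def] by (subst pd_metric) simp_all

end

section \<open>Algebra of three-index tensors\<close>

lemma cyclic_nijenhuis_imp_sym: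
  fixes D :: "'n::finite \<Rightarrow> 'n \<Rightarrow> 'n \<Rightarrow> real"
  assumes sym: "\<And>i j k. D i j k = D i k j"
    and cyclic: "\<And>i j k. D i j k + D j i k + D k i j = 0"
    and nij: "\<And>k a b. (\<Sum>m\<in>UNIV. L a m * D m k b) - (\<Sum>m\<in>UNIV. L b m * D m k a)
      + (\<Sum>m\<in>UNIV. L k m * D b m a) - (\<Sum>m\<in>UNIV. L k m * D a m b) = 0"
  shows "(\<Sum>m\<in>UNIV. L a m * D j m k) = (\<Sum>m\<in>UNIV. L k m * D j m a)"
proof -
  define F where "F a j k = (\<Sum>m\<in>UNIV. L a m * D j m k)" for a j k
  have "(\<Sum>m\<in>UNIV. L a m * D m k b) = - F a k b - F a b k" for a k b
  proof -
    have "D m k b = - D k m b - D b m k" for m using cyclic[of m k b] by simp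
    then show ?thesis
      by (simp add: F_def right_diff_distrib sum_subtractf sum_negf)
  qed
  then have N: "- F a k b - F a b k + F b k a + F b a k + F k b a - F k a b = 0" for k a b
    using nij[of a k b] by (simp add: F_def)
  show ?thesis
    \<comment> \<open>For the skew differences p = \<open>F j a k - F k a j\<close>, q =
      \<open>F k j a - F a j k\<close> and r = \<open>F a k j - F j k a\<close>, the three instances
      read, up to order, p = q + r, q = p + r and r = p + q; so all vanish.\<close>
    using N[of a j k] N[of j k a] N[of k a j] unfolding F_def by linarith
qed

text \<open>Algebraic form of the uniqueness of the Levi-Civita connection.\<close>

lemma sym_skew_imp_zero:
  fixes X :: "'n::finite \<Rightarrow> 'n \<Rightarrow> 'n \<Rightarrow> real"
  assumes skew: "\<And>i j k. X i j k + X i k j = 0"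
    and sym: "\<And>a j k. (\<Sum>s\<in>UNIV. L a s * X s j k) = (\<Sum>s\<in>UNIV. L k s * X s j a)"
  shows "(\<Sum>s\<in>UNIV. L a s * X s j k) = 0"
proof -
  define Y where "Y a j k = (\<Sum>s\<in>UNIV. L a s * X s j k)" for a j k
  have "Y a j k + Y a k j = 0" for a j k
    unfolding Y_def by (simp add: sum.distrib[symmetric] distrib_left[symmetric] skew)
  \<comment> \<open>Alternately exchanging the last two slots (skew) and the outer two (symmetric)
    returns to \<open>Y a j k\<close> with the opposite sign.\<close>
  from this[of a j k] this[of j a k] this[of k a j] show ?thesis
    using sym[of a j k] sym[of a k j] sym[of j a k] unfolding Y_def by linarith
qed

text \<open>Leibniz rule: the connection terms of the contracted index, upper in \<open>P\<close>
  and lower in \<open>X\<close>, cancel after renaming.\<close>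

lemma covd3_contract:
  fixes P :: "'n::finite \<Rightarrow> 'n \<Rightarrow> real^'n \<Rightarrow> real"
  assumes "\<And>i j. P i j differentiable (at x)" and "\<And>i j k. X i j k differentiable (at x)"
  shows "covd3 C (\<lambda>a j k x. \<Sum>s\<in>UNIV. P a s x * X j k s x) l a j k x
    = (\<Sum>s\<in>UNIV. covd2 C P l a s x * X j k s x + P a s x * covd21 C X l j k s x)"
proof -
  have "(\<Sum>s\<in>UNIV. \<Sum>q\<in>UNIV. C s l q x * P a q x * X j k s x)
      = (\<Sum>s\<in>UNIV. \<Sum>q\<in>UNIV. P a s x * (C q l s x * X j k q x))"
    by (subst sum.swap) (simp add: mult_ac)
  moreover have "(\<Sum>q\<in>UNIV. C a l q x * (\<Sum>s\<in>UNIV. P q s x * X j k s x))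
      = (\<Sum>s\<in>UNIV. \<Sum>q\<in>UNIV. C a l q x * P q s x * X j k s x)"
    "(\<Sum>q\<in>UNIV. C j l q x * (\<Sum>s\<in>UNIV. P a s x * X q k s x))
      = (\<Sum>s\<in>UNIV. \<Sum>q\<in>UNIV. P a s x * (C j l q x * X q k s x))"
    "(\<Sum>q\<in>UNIV. C k l q x * (\<Sum>s\<in>UNIV. P a s x * X j q s x))
      = (\<Sum>s\<in>UNIV. \<Sum>q\<in>UNIV. P a s x * (C k l q x * X j q s x))"
    unfolding sum_distrib_left by (subst sum.swap, simp add: mult_ac)+
  ultimately show ?thesis
    unfolding covd3_def covd2_def covd21_def pd_sum_mult[OF assms]
    by (simp add: distrib_left distrib_right right_diff_distrib sum.distrib sum_subtractf
        sum_distrib_left sum_distrib_right)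
qed

lemma covd3_cong:
  assumes "open U" "x \<in> U" and "\<And>y i j k. y \<in> U \<Longrightarrow> S i j k y = T i j k y"
  shows "covd3 C S l i j k x = covd3 C T l i j k x"
  unfolding covd3_def using pd_cong[OF assms(1,2), of "S i j k" "T i j k"] assms(2,3) by simp

section \<open>The obstruction tensor of two metrics\<close>

text \<open>Only one lower index is raised, with \<open>gt\<close>. \<open>Tu\<close> arises from
  this tensor by contraction with \<open>g\<close> alone, which the connection of \<open>g\<close>
  preserves.\<close>

definition obstr_mixed ::
    "'n::finite field2 \<Rightarrow> 'n field2 \<Rightarrow> 'n \<Rightarrow> 'n \<Rightarrow> 'n \<Rightarrow> real^'n \<Rightarrow> real" where
  "obstr_mixed g gt j k s x = (\<Sum>r\<in>UNIV. gt x $ k $ r * obstr g gt j s r x)"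

locale metric_pair = g: metric_on U g + gt: metric_on U gt
  for U :: "(real^'n::finite) set" and g gt :: "'n field2"
begin

abbreviation "\<Gamma> \<equiv> christoffel g"
abbreviation "\<Gamma>t \<equiv> christoffel gt"
abbreviation "T \<equiv> obstr g gt"
abbreviation "Tm \<equiv> obstr_mixed g gt"
abbreviation "Tu \<equiv> obstr_up g gt"
abbreviation "D \<equiv> covd2 (christoffel g) (comps gt)"
abbreviation "Du \<equiv> nabla_up g gt"
abbreviation "L \<equiv> affinor g gt"

lemma obstr_differentiable: "x \<in> U \<Longrightarrow> T i j k differentiable (at x)"
  unfolding obstr_def [abs_def]
  by (intro differentiable_diff g.christoffel_differentiable gt.christoffel_differentiable)

lemma obstr_mixed_differentiable: "x \<in> U \<Longrightarrow> Tm i j k differentiable (at x)"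
  unfolding obstr_mixed_def [abs_def]
  by (intro differentiable_sum finite ballI differentiable_mult gt.metric_differentiable
      obstr_differentiable)

lemma covd2_differentiable: "x \<in> U \<Longrightarrow> D l i j differentiable (at x)"
  unfolding covd2_def [abs_def] comps_def [abs_def]
  by (intro differentiable_add differentiable_sum finite ballI differentiable_mult
      gt.metric_differentiable g.christoffel_differentiable)

lemma obstr_sym: "x \<in> U \<Longrightarrow> T i j k x = T i k j x"
  by (simp add: obstr_def g.christoffel_sym[of x i j k] gt.christoffel_sym[of x i j k])

lemma covd2_sym:
  assumes x: "x \<in> U"
  shows "D l i j x = D l j i x"
proof -
  have "pd l (comps gt i j) x = pd l (comps gt j i) x"
    unfolding comps_def [abs_def] by (rule pd_cong[OF gt.open_U x]) (rule gt.metric_sym)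
  then show ?thesis
    by (simp add: covd2_def comps_def gt.metric_sym[OF x] add.commute)
qed

lemma nabla_up_sym: "x \<in> U \<Longrightarrow> Du i j k x = Du i k j x"
  unfolding nabla_up_def by (simp add: covd2_sym[of x _ j k])

lemma obstr_up_eq: "Tu i j k x = (\<Sum>s\<in>UNIV. comps g i s x * Tm j k s x)"
  by (simp add: obstr_up_def obstr_mixed_def comps_def sum_distrib_left mult.assoc)

lemma obstr_mixed_eq:
  "x \<in> U \<Longrightarrow> Tm j k s x = (\<Sum>m\<in>UNIV. lower g x $ s $ m * Tu m j k x)"
  by (simp add: obstr_up_eq comps_def inverse_pair_cancel_left[OF g.inverse_pairs(2)])

lemma covd2_eq_obstr_mixed:
  assumes x: "x \<in> U"
  shows "D l i j x = - Tm i j l x - Tm j i l x"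
  unfolding covd2_def comps_def [abs_def] gt.pd_metric[OF x] obstr_mixed_def obstr_def
  by (simp add: sum.distrib algebra_simps sum_subtractf gt.metric_sym[OF x, of j])

lemma nabla_up_eq_obstr_up:
  assumes x: "x \<in> U"
  shows "Du i j k x + Tu i j k x + Tu i k j x = 0"
  by (simp add: nabla_up_def obstr_up_eq comps_def covd2_eq_obstr_mixed[OF x] right_diff_distrib
      sum_subtractf sum_negf)

lemma affinor_contract:
  "(\<Sum>s\<in>UNIV. L a s x * f s) = (\<Sum>l\<in>UNIV. gt x $ a $ l * (\<Sum>s\<in>UNIV. lower g x $ l $ s * f s))"
  unfolding affinor_def sum_contract_assoc ..

lemma affinor_obstr_up:
  "x \<in> U \<Longrightarrow> (\<Sum>s\<in>UNIV. L a s x * Tu s j k x) = (\<Sum>s\<in>UNIV. comps gt a s x * Tm j k s x)"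
  by (simp add: affinor_contract comps_def obstr_mixed_eq)

text \<open>Both lower indices of \<open>T j\<close> are now raised by the same metric
  \<open>gt\<close>, so their symmetry becomes visible.\<close>

lemma metric_obstr_mixed_sym:
  assumes x: "x \<in> U"
  shows "(\<Sum>s\<in>UNIV. comps gt a s x * Tm j k s x) = (\<Sum>s\<in>UNIV. comps gt k s x * Tm j a s x)"
  unfolding obstr_mixed_def comps_def sum_distrib_left
  by (subst sum.swap) (simp add: obstr_sym[OF x, of j] mult_ac)

lemma affinor_obstr_up_sym:
  "x \<in> U \<Longrightarrow> (\<Sum>s\<in>UNIV. L a s x * Tu s j k x) = (\<Sum>s\<in>UNIV. L k s x * Tu s j a x)"
  by (simp only: affinor_obstr_up metric_obstr_mixed_sym[of x a])

lemma affinor_eq_0: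
  assumes x: "x \<in> U" and "\<And>a. (\<Sum>s\<in>UNIV. L a s x * f s) = 0"
  shows "f i = 0"
proof -
  have "(\<Sum>s\<in>UNIV. lower g x $ l $ s * f s) = 0" for l
    using assms(2) inverse_pair_injective[OF gt.inverse_pairs(2)[OF x],
        of "\<lambda>l. \<Sum>s\<in>UNIV. lower g x $ l $ s * f s" "\<lambda>_. 0"]
    by (simp add: affinor_contract)
  then show ?thesis
    using inverse_pair_injective[OF g.inverse_pairs(1)[OF x], of f "\<lambda>_. 0"] by simp
qed

lemma covd3_obstr_up:
  assumes x: "x \<in> U"
  shows "covd3 \<Gamma> Tu l i j k x = (\<Sum>s\<in>UNIV. g x $ i $ s * covd21 \<Gamma> Tm l j k s x)"
proof -
  have "Tu = (\<lambda>i j k x. \<Sum>s\<in>UNIV. comps g i s x * Tm j k s x)"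
    by (intro ext) (rule obstr_up_eq)
  moreover have "comps g a b differentiable (at x)" for a b
    unfolding comps_def [abs_def] by (rule g.metric_differentiable[OF x])
  ultimately show ?thesis
    by (simp add: covd3_contract obstr_mixed_differentiable x g.covd2_metric)
      (simp add: comps_def)
qed

text \<open>The slots are permuted to match T^{ijk} = D^{jik}; covariant differentiation commutes
  with the permutation.\<close>

lemma covd3_nabla_up:
  assumes x: "x \<in> U"
  shows "covd3 \<Gamma> (\<lambda>i j k. Du j i k) l j i k x
    = (\<Sum>s\<in>UNIV. g x $ i $ s * covd21 \<Gamma> (\<lambda>i j l. D l i j) l j k s x)"
proof -
  have "Du = (\<lambda>i j k x. \<Sum>s\<in>UNIV. comps g i s x * D s j k x)"
    by (intro ext) (simp add: nabla_up_def comps_def)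
  moreover have "comps g a b differentiable (at x)" for a b
    unfolding comps_def [abs_def] by (rule g.metric_differentiable[OF x])
  ultimately have "covd3 \<Gamma> Du l i j k x
    = (\<Sum>s\<in>UNIV. g x $ i $ s * covd21 \<Gamma> (\<lambda>i j l. D l i j) l j k s x)"
    by (simp add: covd3_contract[where X = "\<lambda>i j l. D l i j"] covd2_differentiable x g.covd2_metric)
      (simp add: comps_def)
  moreover have "covd3 \<Gamma> (\<lambda>i j k. Du j i k) l j i k x = covd3 \<Gamma> Du l i j k x"
    by (simp add: covd3_def add_ac)
  ultimately show ?thesis by simp
qed

section \<open>The Nijenhuis torsion\<close>

lemma pd_affinor:
  assumes x: "x \<in> U"
  shows "pd s (L k j) x = (\<Sum>l\<in>UNIV. D s k l x * lower g x $ l $ j)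
    - (\<Sum>q\<in>UNIV. \<Gamma> k s q x * L q j x) + (\<Sum>q\<in>UNIV. \<Gamma> q s j x * L k q x)"
proof -
  have a: "pd s (\<lambda>y. gt y $ k $ l) x = D s k l x
      - (\<Sum>q\<in>UNIV. \<Gamma> k s q x * gt x $ q $ l) - (\<Sum>q\<in>UNIV. \<Gamma> l s q x * gt x $ k $ q)" for l
    by (simp add: covd2_def comps_def [abs_def] sum.distrib)
  have b: "(\<Sum>i\<in>UNIV. lower g x $ j $ i * \<Gamma> i s l x) = (\<Sum>i\<in>UNIV. \<Gamma> i s l x * lower g x $ i $ j)" for l
    by (intro sum.cong) (simp_all add: g.lower_sym[OF x, of j])
  have "pd s (L k j) x = (\<Sum>l\<in>UNIV. pd s (\<lambda>y. gt y $ k $ l) x * lower g x $ l $ j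
      + gt x $ k $ l * pd s (\<lambda>y. lower g y $ l $ j) x)"
    unfolding affinor_def [abs_def]
    by (rule pd_sum_mult) (simp_all add: gt.metric_differentiable g.lower_differentiable x)
  also have "\<dots> = (\<Sum>l\<in>UNIV. D s k l x * lower g x $ l $ j)
      - (\<Sum>l\<in>UNIV. (\<Sum>q\<in>UNIV. \<Gamma> k s q x * gt x $ q $ l) * lower g x $ l $ j)
      - (\<Sum>l\<in>UNIV. (\<Sum>q\<in>UNIV. \<Gamma> l s q x * gt x $ k $ q) * lower g x $ l $ j)
      + (\<Sum>l\<in>UNIV. gt x $ k $ l * (\<Sum>q\<in>UNIV. lower g x $ l $ q * \<Gamma> q s j x))
      + (\<Sum>l\<in>UNIV. gt x $ k $ l * (\<Sum>q\<in>UNIV. \<Gamma> q s l x * lower g x $ q $ j))"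
    unfolding a g.pd_lower_christoffel[OF x] b left_diff_distrib distrib_left sum.distrib sum_subtractf
    by simp
  also have "(\<Sum>l\<in>UNIV. (\<Sum>q\<in>UNIV. \<Gamma> k s q x * gt x $ q $ l) * lower g x $ l $ j)
      = (\<Sum>q\<in>UNIV. \<Gamma> k s q x * L q j x)"
    unfolding affinor_def sum_contract_assoc ..
  also have "(\<Sum>l\<in>UNIV. gt x $ k $ l * (\<Sum>q\<in>UNIV. lower g x $ l $ q * \<Gamma> q s j x))
      = (\<Sum>q\<in>UNIV. \<Gamma> q s j x * L k q x)"
    unfolding affinor_contract[symmetric] by (simp add: mult.commute)
  also have "(\<Sum>l\<in>UNIV. gt x $ k $ l * (\<Sum>q\<in>UNIV. \<Gamma> q s l x * lower g x $ q $ j))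
      = (\<Sum>l\<in>UNIV. (\<Sum>q\<in>UNIV. \<Gamma> l s q x * gt x $ k $ q) * lower g x $ l $ j)"
    unfolding sum_distrib_left sum_distrib_right by (subst sum.swap) (simp add: mult_ac)
  finally show ?thesis by simp
qed

text \<open>Partial derivatives may be replaced by covariant ones, \<open>E\<close> being the
  covariant derivative of \<open>L\<close>: as \<open>\<Gamma>\<close> is symmetric, the connection
  terms cancel in pairs, by \<open>1\<close>, \<open>2\<close> and \<open>3\<close>.\<close>

lemma nijenhuis_covariant:
  assumes x: "x \<in> U"
  defines "E \<equiv> \<lambda>s k j. \<Sum>l\<in>UNIV. D s k l x * lower g x $ l $ j"
  shows "nijenhuis L k i j x
    = (\<Sum>s\<in>UNIV. L s i x * E s k j) - (\<Sum>s\<in>UNIV. L s j x * E s k i)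
      + (\<Sum>s\<in>UNIV. L k s x * E j s i) - (\<Sum>s\<in>UNIV. L k s x * E i s j)"
proof -
  have 1: "(\<Sum>s\<in>UNIV. L s i x * (\<Sum>q\<in>UNIV. \<Gamma> k s q x * L q j x))
      = (\<Sum>s\<in>UNIV. L s j x * (\<Sum>q\<in>UNIV. \<Gamma> k s q x * L q i x))"
    unfolding sum_distrib_left
    by (subst sum.swap) (simp add: mult_ac g.christoffel_sym[OF x, of k])
  have 2: "(\<Sum>s\<in>UNIV. L s i x * (\<Sum>q\<in>UNIV. \<Gamma> q s j x * L k q x))
      = (\<Sum>s\<in>UNIV. L k s x * (\<Sum>q\<in>UNIV. \<Gamma> s j q x * L q i x))" for i j
    unfolding sum_distrib_left
    by (subst sum.swap) (simp add: mult_ac g.christoffel_sym[OF x, of _ _ j])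
  have 3: "(\<Sum>s\<in>UNIV. L k s x * (\<Sum>q\<in>UNIV. \<Gamma> q j i x * L s q x))
      = (\<Sum>s\<in>UNIV. L k s x * (\<Sum>q\<in>UNIV. \<Gamma> q i j x * L s q x))"
    by (simp add: g.christoffel_sym[OF x, of _ i j])
  show ?thesis
    unfolding nijenhuis_def pd_affinor[OF x] E_def
    by (simp add: distrib_left right_diff_distrib sum.distrib sum_subtractf 1 2 3)
qed

text \<open>Raising both lower indices with \<open>g\<close> leaves a relation between
  \<open>L\<close> and \<open>Du\<close> only, the form suited to the algebra of three-index
  tensors.\<close>

lemma nijenhuis_raised:
  assumes x: "x \<in> U"
  shows "(\<Sum>i\<in>UNIV. (\<Sum>j\<in>UNIV. nijenhuis L k i j x * g x $ j $ b) * g x $ i $ a)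
    = (\<Sum>m\<in>UNIV. L a m x * Du m k b x) - (\<Sum>m\<in>UNIV. L b m x * Du m k a x)
      + (\<Sum>m\<in>UNIV. L k m x * Du b m a x) - (\<Sum>m\<in>UNIV. L k m x * Du a m b x)"
proof -
  define E where "E s k j = (\<Sum>l\<in>UNIV. D s k l x * lower g x $ l $ j)" for s k j
  have E_raised: "(\<Sum>j\<in>UNIV. E s k j * g x $ j $ b) = D s k b x" for s k b
    unfolding E_def by (rule inverse_pair_cancel_right[OF g.inverse_pairs(2)[OF x]])
  have Lg: "(\<Sum>j\<in>UNIV. L s j x * g x $ j $ b) = gt x $ s $ b" for s b
    unfolding affinor_def by (rule inverse_pair_cancel_right[OF g.inverse_pairs(2)[OF x]])
  have LD: "(\<Sum>m\<in>UNIV. L a m x * Du m k b x) = (\<Sum>s\<in>UNIV. gt x $ s $ a * D s k b x)" for a k b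
    unfolding affinor_contract nabla_up_def inverse_pair_cancel_left[OF g.inverse_pairs(2)[OF x]]
    by (simp add: gt.metric_sym[OF x, of a])
  have Dg: "(\<Sum>j\<in>UNIV. D j s a x * g x $ j $ b) = Du b s a x" for s a b
    unfolding nabla_up_def by (simp add: g.metric_sym[OF x, of b] mult.commute)
  note assoc = sum_contract_assoc[symmetric]
  have 1: "(\<Sum>i\<in>UNIV. (\<Sum>j\<in>UNIV. (\<Sum>s\<in>UNIV. L s i x * E s k j) * g x $ j $ b) * g x $ i $ a)
      = (\<Sum>m\<in>UNIV. L a m x * Du m k b x)"
  proof -
    have "(\<Sum>i\<in>UNIV. (\<Sum>s\<in>UNIV. L s i x * D s k b x) * g x $ i $ a)
      = (\<Sum>i\<in>UNIV. (\<Sum>s\<in>UNIV. D s k b x * L s i x) * g x $ i $ a)"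
      by (simp add: mult.commute)
    also have "\<dots> = (\<Sum>m\<in>UNIV. L a m x * Du m k b x)"
      unfolding assoc Lg LD by (simp add: mult.commute)
    finally show ?thesis by (simp only: assoc E_raised)
  qed
  have 2: "(\<Sum>i\<in>UNIV. (\<Sum>j\<in>UNIV. (\<Sum>s\<in>UNIV. L s j x * E s k i) * g x $ j $ b) * g x $ i $ a)
      = (\<Sum>m\<in>UNIV. L b m x * Du m k a x)"
  proof -
    have "(\<Sum>j\<in>UNIV. (\<Sum>s\<in>UNIV. L s j x * E s k i) * g x $ j $ b)
        = (\<Sum>s\<in>UNIV. gt x $ s $ b * E s k i)" for i
    proof -
      have "(\<Sum>j\<in>UNIV. (\<Sum>s\<in>UNIV. L s j x * E s k i) * g x $ j $ b)
        = (\<Sum>j\<in>UNIV. (\<Sum>s\<in>UNIV. E s k i * L s j x) * g x $ j $ b)"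
        by (simp only: mult.commute)
      then show ?thesis unfolding assoc Lg by (simp only: mult.commute)
    qed
    then show ?thesis by (simp only: assoc E_raised LD)
  qed
  have 3: "(\<Sum>i\<in>UNIV. (\<Sum>j\<in>UNIV. (\<Sum>s\<in>UNIV. L k s x * E j s i) * g x $ j $ b) * g x $ i $ a)
      = (\<Sum>m\<in>UNIV. L k m x * Du b m a x)"
  proof -
    have "(\<Sum>i\<in>UNIV. (\<Sum>j\<in>UNIV. (\<Sum>s\<in>UNIV. L k s x * E j s i) * g x $ j $ b) * g x $ i $ a)
      = (\<Sum>j\<in>UNIV. (\<Sum>i\<in>UNIV. (\<Sum>s\<in>UNIV. L k s x * E j s i) * g x $ i $ a) * g x $ j $ b)"
      by (simp only: sum_distrib_right) (subst sum.swap, simp only: mult_ac)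
    then show ?thesis by (simp only: assoc E_raised Dg)
  qed
  have 4: "(\<Sum>i\<in>UNIV. (\<Sum>j\<in>UNIV. (\<Sum>s\<in>UNIV. L k s x * E i s j) * g x $ j $ b) * g x $ i $ a)
      = (\<Sum>m\<in>UNIV. L k m x * Du a m b x)"
    by (simp only: assoc E_raised Dg)
  show ?thesis
    unfolding nijenhuis_covariant[OF x, folded E_def] left_diff_distrib distrib_right sum.distrib sum_subtractf
      1 2 3 4 ..
qed

lemma nijenhuis_eq_0_iff:
  assumes x: "x \<in> U"
  shows "(\<forall>k i j. nijenhuis L k i j x = 0) \<longleftrightarrow>
    (\<forall>k a b. (\<Sum>m\<in>UNIV. L a m x * Du m k b x) - (\<Sum>m\<in>UNIV. L b m x * Du m k a x)
      + (\<Sum>m\<in>UNIV. L k m x * Du b m a x) - (\<Sum>m\<in>UNIV. L k m x * Du a m b x) = 0)"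
    (is "_ \<longleftrightarrow> ?R")
proof
  show ?R if "\<forall>k i j. nijenhuis L k i j x = 0"
    using that unfolding nijenhuis_raised[OF x, symmetric] by simp
next
  have inj: "f = (\<lambda>_. 0)" if "\<And>a. (\<Sum>i\<in>UNIV. f i * g x $ i $ a) = 0" for f
  proof
    fix i
    show "f i = 0"
      using inverse_pair_injective[OF g.inverse_pairs(2)[OF x], of f "\<lambda>_. 0" i] that
      by (simp add: g.metric_sym[OF x] mult.commute)
  qed
  assume R: ?R
  show "\<forall>k i j. nijenhuis L k i j x = 0"
  proof (intro allI)
    fix k i j
    have "(\<lambda>i. \<Sum>j\<in>UNIV. nijenhuis L k i j x * g x $ j $ b) = (\<lambda>_. 0)" for b
      using R by (intro inj) (simp add: nijenhuis_raised[OF x])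
    then have "(\<lambda>j. nijenhuis L k i j x) = (\<lambda>_. 0)"
      by (intro inj) meson
    then show "nijenhuis L k i j x = 0" by meson
  qed
qed

section \<open>Passage between the obstruction tensor and the derivative of
  \<open>gt\<close>\<close>

text \<open>By symmetry, the two \<open>Tu\<close> terms in \<open>nabla_up_eq_obstr_up\<close> are
  the last two of the cyclic sum.\<close>

lemma obstr_up_eq_nabla_up:
  assumes x: "x \<in> U"
    and sym: "\<And>i j k. Tu i j k x = Tu k j i x"
    and cyclic: "\<And>i j k. Tu i j k x + Tu j k i x + Tu k i j x = 0"
  shows "Tu i j k x = Du j i k x"
  using nabla_up_eq_obstr_up[OF x, of j i k] cyclic[of i j k] sym[of j i k] by linarith

lemma parallel_imp_linear:
  assumes x: "x \<in> U"
    and eq: "\<And>y i j k. y \<in> U \<Longrightarrow> Tu i j k y = Du j i k y"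
    and par: "\<And>l i j k. covd3 \<Gamma> Tu l i j k x = 0"
  shows "covd21 \<Gamma> (\<lambda>i j l. D l i j) m i j l x = 0"
proof -
  have "covd3 \<Gamma> Tu m i p j x = covd3 \<Gamma> (\<lambda>i j k. Du j i k) m i p j x" for p
    by (rule covd3_cong[OF g.open_U x]) (rule eq)
  then have "(\<Sum>s\<in>UNIV. g x $ p $ s * covd21 \<Gamma> (\<lambda>i j l. D l i j) m i j s x) = 0" for p
    unfolding par covd3_nabla_up[OF x] by simp
  then show ?thesis
    using inverse_pair_injective[OF g.inverse_pairs(2)[OF x],
        of "\<lambda>s. covd21 \<Gamma> (\<lambda>i j l. D l i j) m i j s x" "\<lambda>_. 0"] by simp
qed

lemma sym_cyclic_imp_nijenhuis:
  assumes x: "x \<in> U"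
    and sym: "\<And>i j k. Tu i j k x = Tu k j i x"
    and cyclic: "\<And>i j k. Tu i j k x + Tu j k i x + Tu k i j x = 0"
  shows "nijenhuis L k i j x = 0"
proof -
  have "(\<Sum>m\<in>UNIV. L a m x * Du m k b x) - (\<Sum>m\<in>UNIV. L b m x * Du m k a x)
      + (\<Sum>m\<in>UNIV. L k m x * Du b m a x) - (\<Sum>m\<in>UNIV. L k m x * Du a m b x) = 0" for k a b
  proof -
    have eq: "Du j i k x = Tu i j k x" for i j k
      using obstr_up_eq_nabla_up[OF x sym cyclic] by simp
    \<comment> \<open>Moves the contracted index to the first slot of \<open>Tu\<close>, where
      \<open>affinor_obstr_up_sym\<close> applies; the resulting six terms cancel in pairs.\<close>
    have Lsplit: "(\<Sum>m\<in>UNIV. L a m x * Tu k m b x)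
        = - (\<Sum>m\<in>UNIV. L a m x * Tu m b k x) - (\<Sum>m\<in>UNIV. L a m x * Tu m k b x)" for a b
    proof -
      have "Tu k m b x = - Tu m b k x - Tu m k b x" for m
        using cyclic[of k m b] sym[of b k m] by linarith
      then show ?thesis
        by (simp add: right_diff_distrib sum_subtractf sum_negf)
    qed
    show ?thesis
      unfolding eq Lsplit
      using affinor_obstr_up_sym[OF x, of a k b] affinor_obstr_up_sym[OF x, of k b a]
        affinor_obstr_up_sym[OF x, of k a b] by linarith
  qed
  then show ?thesis
    using nijenhuis_eq_0_iff[OF x] by blast
qed

text \<open>The difference \<open>X\<close> solves the homogeneous form of the two identities that
  determine \<open>Tu\<close>: the Killing condition makes it skew, the torsion makes
  \<open>L X\<close> symmetric. Hence \<open>L X\<close> vanishes, and \<open>L\<close> is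
  invertible.\<close>

lemma killing_nijenhuis_imp_obstr_up_eq:
  assumes x: "x \<in> U"
    and killing: "\<And>i j k. Du i j k x + Du j i k x + Du k i j x = 0"
    and nij: "\<And>k i j. nijenhuis L k i j x = 0"
  shows "Tu i j k x = Du j i k x"
proof -
  define X where "X i j k = Tu i j k x - Du j i k x" for i j k
  have "X i j k + X i k j = 0" for i j k
    using nabla_up_eq_obstr_up[OF x, of i j k] killing[of i j k] unfolding X_def by linarith
  moreover have "(\<Sum>s\<in>UNIV. L a s x * X s j k) = (\<Sum>s\<in>UNIV. L k s x * X s j a)" for a j k
  proof -
    have "(\<Sum>m\<in>UNIV. L a m x * Du j m k x) = (\<Sum>m\<in>UNIV. L k m x * Du j m a x)"
      using nijenhuis_eq_0_iff[OF x] nij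
      by (intro cyclic_nijenhuis_imp_sym[where D = "\<lambda>i j k. Du i j k x" and L = "\<lambda>a m. L a m x"]
          nabla_up_sym x killing) blast
    then show ?thesis
      using affinor_obstr_up_sym[OF x, of a j k]
      by (simp add: X_def right_diff_distrib sum_subtractf)
  qed
  ultimately have "(\<Sum>s\<in>UNIV. L a s x * X s j k) = 0" for a
    by (rule sym_skew_imp_zero)
  then have "X i j k = 0" by (rule affinor_eq_0[OF x])
  then show ?thesis by (simp add: X_def)
qed

end

section \<open>Consequences of a parallel obstruction tensor\<close>

locale parallel_obstr = metric_pair +
  assumes obstr_up_nabla_up: "\<And>x i j k. x \<in> U \<Longrightarrow> Tu i j k x = Du j i k x"
    and killing: "\<And>x i j k. x \<in> U \<Longrightarrow> Du i j k x + Du j i k x + Du k i j x = 0"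
    and linear: "\<And>x m i j l. x \<in> U \<Longrightarrow> covd21 \<Gamma> (\<lambda>i j l. D l i j) m i j l x = 0"
begin

lemma obstr_up_sym: "x \<in> U \<Longrightarrow> Tu i j k x = Tu k j i x"
  by (simp only: obstr_up_nabla_up nabla_up_sym[of x j i])

lemma obstr_up_cyclic: "x \<in> U \<Longrightarrow> Tu i j k x + Tu j k i x + Tu k i j x = 0"
  using killing[of x j i k] nabla_up_sym[of x k j i] nabla_up_sym[of x i k j]
  by (simp add: obstr_up_nabla_up)

lemma covd3_obstr_up_eq_0:
  assumes x: "x \<in> U"
  shows "covd3 \<Gamma> Tu l i j k x = 0"
  using covd3_cong[OF g.open_U x obstr_up_nabla_up] covd3_nabla_up[OF x] linear[OF x] by simp

lemma covd21_obstr_mixed_eq_0: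
  assumes x: "x \<in> U"
  shows "covd21 \<Gamma> Tm l j k s x = 0"
  using inverse_pair_injective[OF g.inverse_pairs(2)[OF x],
      of "\<lambda>s. covd21 \<Gamma> Tm l j k s x" "\<lambda>_. 0"]
    covd3_obstr_up_eq_0[OF x] covd3_obstr_up[OF x] by simp

text \<open>The tensor T^{aps} g_{sm} T^{mjk}; the quadratic Mokhov condition, with its last index
  raised by \<open>gt\<close>, is its symmetry in the two middle indices.\<close>

definition obstr_sq where "obstr_sq a p j k x = (\<Sum>s\<in>UNIV. Tu a p s x * Tm j k s x)"

text \<open>The outer symmetry of \<open>Tu\<close>, applied to both factors.\<close>

lemma obstr_sq_reverse:
  assumes x: "x \<in> U"
  shows "obstr_sq a p j k x = obstr_sq k j p a x"
  unfolding obstr_sq_def obstr_mixed_eq[OF x] sum_distrib_left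
  by (subst sum.swap)
    (simp add: mult_ac g.lower_sym[OF x] obstr_up_sym[OF x, of _ j k] obstr_up_sym[OF x, of _ p a])

text \<open>The covariant derivative of the symmetry of
  \<open>L\<^sup>a\<^sub>s T\<^sup>s\<^sup>j\<^sup>k\<close> in \<open>a\<close> and \<open>k\<close>.\<close>

lemma obstr_sq_swap_outer:
  assumes x: "x \<in> U"
  shows "obstr_sq a p j k x = obstr_sq k p j a x"
proof -
  let ?W = "\<lambda>a j k y. \<Sum>s\<in>UNIV. comps gt a s y * Tm j k s y"
  have "comps gt a b differentiable (at x)" for a b
    unfolding comps_def [abs_def] by (rule gt.metric_differentiable[OF x])
  then have W: "covd3 \<Gamma> ?W l a j k x = (\<Sum>s\<in>UNIV. D l a s x * Tm j k s x)" for l a j k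
    by (simp add: covd3_contract obstr_mixed_differentiable[OF x] covd21_obstr_mixed_eq_0[OF x])
  have "covd3 \<Gamma> ?W l a j k x = covd3 \<Gamma> (\<lambda>a j k. ?W k j a) l a j k x" for l
    by (rule covd3_cong[OF g.open_U x]) (rule metric_obstr_mixed_sym)
  also have "covd3 \<Gamma> (\<lambda>a j k. ?W k j a) l a j k x = covd3 \<Gamma> ?W l k j a x" for l
    by (simp add: covd3_def add_ac)
  finally have DT: "(\<Sum>s\<in>UNIV. D l a s x * Tm j k s x) = (\<Sum>s\<in>UNIV. D l k s x * Tm j a s x)" for l
    by (simp only: W)
  \<comment> \<open>Contracting \<open>l\<close> with \<open>g\<close> turns \<open>D l\<close> into
    \<open>Du p\<close>, which is \<open>Tu\<close> again.\<close>
  have "obstr_sq a p j k x = (\<Sum>l\<in>UNIV. g x $ p $ l * (\<Sum>s\<in>UNIV. D l a s x * Tm j k s x))" for a k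
    unfolding obstr_sq_def obstr_up_nabla_up[OF x] nabla_up_def sum_contract_assoc ..
  then show ?thesis by (simp only: DT)
qed

text \<open>Reversing all four indices and then exchanging the outer two exchanges the middle
  ones.\<close>

lemma obstr_sq_swap_inner: "x \<in> U \<Longrightarrow> obstr_sq a p j k x = obstr_sq a j p k x"
  by (metis obstr_sq_reverse obstr_sq_swap_outer)

lemma obstr_mixed_metric: "x \<in> U \<Longrightarrow> (\<Sum>l\<in>UNIV. gt x $ m $ l * T i l s x) = Tm i m s x"
  by (simp add: obstr_mixed_def obstr_sym[of x i s])

lemma obstr_up_obstr_sym:
  assumes x: "x \<in> U"
  shows "(\<Sum>s\<in>UNIV. Tu i j s x * T r s t x) = (\<Sum>s\<in>UNIV. Tu i r s x * T j s t x)"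
proof -
  have "(\<Sum>t\<in>UNIV. gt x $ k $ t * (\<Sum>s\<in>UNIV. Tu i j s x * T r s t x)) = obstr_sq i j r k x" for k j r
    unfolding obstr_sq_def obstr_mixed_def sum_distrib_left
    by (subst sum.swap) (simp add: mult_ac)
  then show ?thesis
    using obstr_sq_swap_inner[OF x]
      inverse_pair_injective[OF gt.inverse_pairs(2)[OF x],
        of "\<lambda>t. \<Sum>s\<in>UNIV. Tu i j s x * T r s t x" "\<lambda>t. \<Sum>s\<in>UNIV. Tu i r s x * T j s t x"]
    by simp
qed

text \<open>The connections differ by \<open>T\<close>, so only the quadratic terms
  \<open>?c\<close> remain. With \<open>l\<close> raised by \<open>gt\<close> and the middle one
  split by the cyclic identity, they are four values of \<open>obstr_sq\<close> that cancel by inner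
  exchanges.\<close>

lemma covd3_tilde_obstr_up_eq_0:
  assumes x: "x \<in> U"
  shows "covd3 \<Gamma>t Tu l i j k x = 0"
proof -
  let ?c = "\<lambda>l. (\<Sum>s\<in>UNIV. T i l s x * Tu s j k x) + (\<Sum>s\<in>UNIV. T j l s x * Tu i s k x)
      + (\<Sum>s\<in>UNIV. T k l s x * Tu i j s x)"
  have "covd3 \<Gamma>t Tu l i j k x = covd3 \<Gamma> Tu l i j k x + ?c l" for l
    by (simp add: covd3_def obstr_def sum.distrib left_diff_distrib sum_subtractf)
  then have c: "covd3 \<Gamma>t Tu l i j k x = ?c l" for l
    by (simp add: covd3_obstr_up_eq_0[OF x])
  have 1: "(\<Sum>s\<in>UNIV. Tm i m s x * Tu s j k x) = obstr_sq k j i m x" for m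
    unfolding obstr_sq_def by (simp add: obstr_up_sym[OF x, of _ j k] mult.commute)
  have 2: "(\<Sum>s\<in>UNIV. Tm j m s x * Tu i s k x) = - obstr_sq i k j m x - obstr_sq k i j m x" for m
  proof -
    have "Tu i s k x = - Tu i k s x - Tu k i s x" for s
      using obstr_up_cyclic[OF x, of i s k] obstr_up_sym[OF x, of s k i] by linarith
    then show ?thesis
      unfolding obstr_sq_def by (simp add: right_diff_distrib sum_subtractf sum_negf mult.commute)
  qed
  have 3: "(\<Sum>s\<in>UNIV. Tm k m s x * Tu i j s x) = obstr_sq i j k m x" for m
    unfolding obstr_sq_def by (simp add: mult.commute)
  have "(\<Sum>l\<in>UNIV. gt x $ m $ l * ?c l) = 0" for m
    unfolding distrib_left sum.distrib sum_contract_assoc obstr_mixed_metric[OF x] 1 2 3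
    using obstr_sq_swap_inner[OF x, of k j i m] obstr_sq_swap_inner[OF x, of i j k m] by simp
  then show ?thesis
    using inverse_pair_injective[OF gt.inverse_pairs(2)[OF x], of ?c "\<lambda>_. 0"] by (simp add: c)
qed

lemma mokhov: "mokhov_on U g gt"
  unfolding mokhov_on_def
  by (intro ballI conjI allI obstr_up_sym obstr_up_cyclic obstr_up_obstr_sym
      covd3_obstr_up_eq_0 covd3_tilde_obstr_up_eq_0)

section \<open>Flatness\<close>

text \<open>\<open>covd_obstr k i l j\<close> is the covariant derivative \<open>\<nabla>\<^sub>k T\<^sup>i\<^sub>l\<^sub>j\<close>.\<close>

definition covd_obstr where
  "covd_obstr k i l j x = pd k (T i l j) x + (\<Sum>q\<in>UNIV. \<Gamma> i k q x * T q l j x)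
    - (\<Sum>q\<in>UNIV. \<Gamma> q k l x * T i q j x) - (\<Sum>q\<in>UNIV. \<Gamma> q k j x * T i l q x)"

text \<open>The curvature of a connection shifted by a tensor; the terms with
  \<open>\<Gamma> q k l\<close> drop out on antisymmetrizing in \<open>k\<close> and
  \<open>l\<close>.\<close>

lemma riemann_eq:
  assumes x: "x \<in> U"
  shows "riemann gt i j k l x = riemann g i j k l x + covd_obstr k i l j x - covd_obstr l i k j x
    + (\<Sum>s\<in>UNIV. T i k s x * T s l j x) - (\<Sum>s\<in>UNIV. T i l s x * T s k j x)"
proof -
  have eq: "\<Gamma>t a b c = (\<lambda>y. \<Gamma> a b c y + T a b c y)" for a b c
    by (auto simp: obstr_def)
  have pd: "pd m (\<Gamma>t a b c) x = pd m (\<Gamma> a b c) x + pd m (T a b c) x" for m a b c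
    unfolding eq by (rule pd_add[OF g.christoffel_differentiable[OF x] obstr_differentiable[OF x]])
  have "(\<Sum>q\<in>UNIV. \<Gamma> q k l x * T i q j x) = (\<Sum>q\<in>UNIV. \<Gamma> q l k x * T i q j x)"
    by (simp add: g.christoffel_sym[OF x, of _ k l])
  then show ?thesis
    unfolding riemann_def pd covd_obstr_def
    by (simp add: eq distrib_left distrib_right sum.distrib sum_subtractf mult.commute)
qed

text \<open>It is \<open>Tm\<close> that is parallel: the Leibniz rule passes the derivative of
  \<open>T\<close> to \<open>gt\<close>, and the derivative of \<open>gt\<close> is linear in
  \<open>Tm\<close>.\<close>

lemma metric_covd_obstr:
  assumes x: "x \<in> U"
  shows "(\<Sum>r\<in>UNIV. gt x $ m $ r * covd_obstr k i l r x)
    = (\<Sum>r\<in>UNIV. (Tm m r k x + Tm r m k x) * T i l r x)"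
proof -
  have pdTm: "pd k (Tm i m l) x = (\<Sum>r\<in>UNIV. pd k (\<lambda>y. gt y $ m $ r) x * T i l r x)
      + (\<Sum>r\<in>UNIV. gt x $ m $ r * pd k (T i l r) x)"
    unfolding obstr_mixed_def [abs_def]
    by (subst pd_sum_mult)
       (simp_all add: gt.metric_differentiable obstr_differentiable x sum.distrib)
  have pdgt: "pd k (\<lambda>y. gt y $ m $ r) x = D k m r x
      - (\<Sum>q\<in>UNIV. \<Gamma> m k q x * gt x $ q $ r) - (\<Sum>q\<in>UNIV. \<Gamma> r k q x * gt x $ m $ q)" for r
    by (simp add: covd2_def comps_def [abs_def] sum.distrib)
  have 1: "(\<Sum>q\<in>UNIV. \<Gamma> i k q x * Tm q m l x)
      = (\<Sum>r\<in>UNIV. gt x $ m $ r * (\<Sum>q\<in>UNIV. \<Gamma> i k q x * T q l r x))"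
    unfolding obstr_mixed_def sum_distrib_left by (subst sum.swap) (simp add: mult_ac)
  have 2: "(\<Sum>q\<in>UNIV. \<Gamma> q k l x * Tm i m q x)
      = (\<Sum>r\<in>UNIV. gt x $ m $ r * (\<Sum>q\<in>UNIV. \<Gamma> q k l x * T i q r x))"
    unfolding obstr_mixed_def sum_distrib_left by (subst sum.swap) (simp add: mult_ac)
  have 3: "(\<Sum>q\<in>UNIV. \<Gamma> m k q x * Tm i q l x)
      = (\<Sum>r\<in>UNIV. (\<Sum>q\<in>UNIV. \<Gamma> m k q x * gt x $ q $ r) * T i l r x)"
    unfolding obstr_mixed_def by (rule sum_contract_assoc)
  have 4: "(\<Sum>r\<in>UNIV. (\<Sum>q\<in>UNIV. \<Gamma> r k q x * gt x $ m $ q) * T i l r x)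
      = (\<Sum>r\<in>UNIV. gt x $ m $ r * (\<Sum>q\<in>UNIV. \<Gamma> q k r x * T i l q x))"
    unfolding sum_distrib_left sum_distrib_right by (subst sum.swap) (simp add: mult_ac)
  have "0 = covd21 \<Gamma> Tm k i m l x" by (simp add: covd21_obstr_mixed_eq_0[OF x])
  also have "\<dots> = (\<Sum>r\<in>UNIV. D k m r x * T i l r x)
      + (\<Sum>r\<in>UNIV. gt x $ m $ r * covd_obstr k i l r x)"
    unfolding covd21_def covd_obstr_def pdTm pdgt
    by (simp add: sum.distrib sum_subtractf left_diff_distrib right_diff_distrib distrib_left
        1 2 3 4)
  finally show ?thesis
    unfolding covd2_eq_obstr_mixed[OF x]
    by (simp add: left_diff_distrib distrib_right sum_subtractf sum.distrib sum_negf)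
qed

text \<open>The quadratic condition with its first index lowered; the factor \<open>gt\<close>
  hidden in \<open>Tm\<close> is then shifted to the other factor.\<close>

lemma obstr_mixed_obstr_sym:
  assumes x: "x \<in> U"
  shows "(\<Sum>s\<in>UNIV. Tm m s k x * T i l s x) = (\<Sum>s\<in>UNIV. Tm m s l x * T i k s x)"
proof -
  have "(\<Sum>k\<in>UNIV. g x $ a $ k * (\<Sum>s\<in>UNIV. Tm m s k x * T i s l x))
      = (\<Sum>s\<in>UNIV. Tu a m s x * T i s l x)" for a m i
    unfolding sum_contract_assoc obstr_up_eq comps_def ..
  then have "(\<Sum>s\<in>UNIV. Tm m s k x * T i s l x) = (\<Sum>s\<in>UNIV. Tm i s k x * T m s l x)"
    using obstr_up_obstr_sym[OF x, of _ m i l]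
      inverse_pair_injective[OF g.inverse_pairs(2)[OF x],
        of "\<lambda>k. \<Sum>s\<in>UNIV. Tm m s k x * T i s l x" "\<lambda>k. \<Sum>s\<in>UNIV. Tm i s k x * T m s l x"]
    by simp
  also have "\<dots> = (\<Sum>s\<in>UNIV. Tm m s l x * T i k s x)"
    unfolding obstr_mixed_def sum_distrib_right
    by (subst sum.swap)
       (simp add: mult_ac gt.metric_sym[OF x] obstr_sym[OF x, of m _ l])
  finally show ?thesis by (simp add: obstr_sym[OF x, of i _ l])
qed

lemma flat_tilde:
  assumes "flat_on U g"
  shows "flat_on U gt"
  unfolding flat_on_def
proof (intro ballI allI)
  fix x i j k l
  assume x: "x \<in> U"
  have TT: "(\<Sum>r\<in>UNIV. gt x $ m $ r * (\<Sum>s\<in>UNIV. T i k s x * T s l r x))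
      = (\<Sum>s\<in>UNIV. Tm s m l x * T i k s x)" for m k l
    unfolding obstr_mixed_def sum_distrib_left sum_distrib_right
    by (subst sum.swap) (simp add: mult_ac)
  \<comment> \<open>One half of the terms from \<open>metric_covd_obstr\<close> cancels the products
    \<open>TT\<close>; the other half is symmetric in \<open>k\<close> and \<open>l\<close>, so its
    antisymmetrization vanishes.\<close>
  have "(\<Sum>r\<in>UNIV. gt x $ m $ r * riemann gt i r k l x) = 0" for m
    using assms x
    by (simp add: riemann_eq flat_on_def distrib_left right_diff_distrib sum.distrib sum_subtractf
        metric_covd_obstr TT distrib_right obstr_mixed_obstr_sym[OF x, of m k i l])
  then show "riemann gt i j k l x = 0"
    using inverse_pair_injective[OF gt.inverse_pairs(2)[OF x], of "\<lambda>r. riemann gt i r k l x" "\<lambda>_. 0"]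
    by simp
qed

end

section \<open>Equivalence with the Mokhov conditions, and flatness of \<open>gt\<close>\<close>

theorem theorem2:
  fixes U :: "(real^'n::finite) set" and g gt :: "'n field2"
  assumes "open U" and "connected U"
    and "smooth_metric_on U g" and "smooth_metric_on U gt"
    and "nondeg_sym_on U g" and "nondeg_sym_on U gt"
    and "flat_on U g"
  shows "(mokhov_on U g gt \<longleftrightarrow>
            cond_linear_on U g gt \<and> cond_nijenhuis_on U g gt \<and> cond_killing_on U g gt)
       \<and> (cond_linear_on U g gt \<and> cond_nijenhuis_on U g gt \<and> cond_killing_on U g gt
            \<longrightarrow> flat_on U gt)"
proof -
  interpret metric_pair U g gt
    using assms by unfold_locales
  have "cond_linear_on U g gt \<and> cond_nijenhuis_on U g gt \<and> cond_killing_on U g gt"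
    if M: "mokhov_on U g gt"
  proof (intro conjI)
    have sym: "Tu i j k x = Tu k j i x"
      and cyclic: "Tu i j k x + Tu j k i x + Tu k i j x = 0"
      and par: "covd3 \<Gamma> Tu l i j k x = 0" if "x \<in> U" for x l i j k
      using M that unfolding mokhov_on_def by blast+
    note eq = obstr_up_eq_nabla_up[OF _ sym cyclic]
    show "cond_linear_on U g gt"
      unfolding cond_linear_on_def
      by (intro ballI allI parallel_imp_linear eq par) auto
    show "cond_nijenhuis_on U g gt"
      unfolding cond_nijenhuis_on_def
      by (intro ballI allI sym_cyclic_imp_nijenhuis sym cyclic) auto
    show "cond_killing_on U g gt"
      unfolding cond_killing_on_def
    proof (intro ballI allI)
      fix x i j k assume x: "x \<in> U"
      \<comment> \<open>By T^{ijk} = D^{jik}, this is the cyclic sum up to the symmetry of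
        \<open>Du\<close> in its last two slots.\<close>
      show "Du i k j x + Du k i j x + Du j i k x = 0"
        using cyclic[OF x, of i j k] eq[OF x, of i j k] eq[OF x, of j k i] eq[OF x, of k i j]
          nabla_up_sym[OF x, of k i j] x by simp
    qed
  qed
  moreover have "mokhov_on U g gt \<and> flat_on U gt"
    if lin: "cond_linear_on U g gt" and nij: "cond_nijenhuis_on U g gt"
      and kil: "cond_killing_on U g gt"
  proof -
    have killing: "Du i j k x + Du j i k x + Du k i j x = 0" if x: "x \<in> U" for x i j k
      using kil x nabla_up_sym[OF x, of i j k] unfolding cond_killing_on_def by metis
    \<comment> \<open>Conditions (2) and (3) identify \<open>Tu\<close>; condition (1) makes it
      parallel.\<close>
    interpret parallel_obstr U g gt
    proof
      show "Tu i j k x = Du j i k x" if x: "x \<in> U" for x i j k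
        using nij x unfolding cond_nijenhuis_on_def
        by (intro killing_nijenhuis_imp_obstr_up_eq killing x) blast
    qed (use killing lin in \<open>auto simp: cond_linear_on_def\<close>)
    show ?thesis using mokhov flat_tilde assms(7) by blast
  qed
  ultimately show ?thesis by blast
qed

end
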